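(* There exist a metric space $(X^-,D)$ and a map $F:X^-\to X^-$ such that: (i) $X^-$ is compact with respect to $D$ and $F$ is a homeomorphism. (ii) For some $\varepsilon>0$ we have both $$\liminf_{T\to\infty}\frac{\ln \mathrm{span}(X^-,\varepsilon,D_T)}{T}<\limsup_{T\to\infty}\frac{\ln \mathrm{span}(X^-,\varepsilon,D_T)}{T}$$ and $$\liminf_{T\to\infty}\frac{\ln \mathrm{sep}(X^-,\varepsilon,D_T)}{T}<\limsup_{T\to\infty}\frac{\ln \mathrm{sep}(X^-,\varepsilon,D_T)}{T}.$$ (iii) $h(X^-,F)<\infty$.
   Context: For a metric space $(X,D)$, a continuous map $F:X\to X$ and an integer $T\ge 1$, $D_T(x,y)=\max\{D(F^t(x),F^t(y)):0\le t\le T-1\}$. Limits as $T\to\infty$ are over positive integers. For a metric $\mu$ on $X$ and $\varepsilon>0$: a set of points is $\varepsilon$-separated if any two distinct points in it have $\mu$-distance $\ge\varepsilon$, and $\mathrm{sep}(X,\varepsilon,\mu)$ is the maximum size of an $\varepsilon$-separated subset of $X$; a set $S\subset X$ is $\varepsilon$-spanning if for all $x\in X$ there is $s\in S$ with $\mu(s,x)<\varepsilon$, and $\mathrm{span}(X,\varepsilon,\mu)$ is the minimum size of an $\varepsilon$-spanning subset of $X$. The topological entropy is $h(X,F)=\lim_{\varepsilon\to0^+}\limsup_{T\to\infty}\frac{\ln \mathrm{span}(X,\varepsilon,D_T)}{T}\in[0,\infty]$ (the same value is obtained with sep). *)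

theory Defs
  imports "HOL-Analysis.Analysis"
begin

text \<open>
  A metric space is a carrier set \<open>X\<close> together with a function \<open>D\<close> satisfying the library
  locale \<^locale>\<open>Metric_space\<close>. A map from \<open>X\<close> to itself is a total function on the ambient
  type of which only the values on \<open>X\<close> matter.
\<close>

text \<open>The metric \<open>D\<^sub>T\<close>; it is meaningful for \<open>T \<ge> 1\<close> only.\<close>

definition dyn_dist :: "('a \<Rightarrow> 'a \<Rightarrow> real) \<Rightarrow> ('a \<Rightarrow> 'a) \<Rightarrow> nat \<Rightarrow> 'a \<Rightarrow> 'a \<Rightarrow> real" where
  "dyn_dist D F T x y = Max ((\<lambda>t. D ((F ^^ t) x) ((F ^^ t) y)) ` {0..<T})"

definition separated :: "'a set \<Rightarrow> real \<Rightarrow> ('a \<Rightarrow> 'a \<Rightarrow> real) \<Rightarrow> bool" where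
  "separated S \<epsilon> \<mu> \<longleftrightarrow> (\<forall>x\<in>S. \<forall>y\<in>S. x \<noteq> y \<longrightarrow> \<mu> x y \<ge> \<epsilon>)"

definition spanning :: "'a set \<Rightarrow> 'a set \<Rightarrow> real \<Rightarrow> ('a \<Rightarrow> 'a \<Rightarrow> real) \<Rightarrow> bool" where
  "spanning X S \<epsilon> \<mu> \<longleftrightarrow> S \<subseteq> X \<and> (\<forall>x\<in>X. \<exists>s\<in>S. \<mu> s x < \<epsilon>)"

text \<open>
  Sizes take values in \<^typ>\<open>enat\<close>: \<open>sep\<close> is \<open>\<infinity>\<close> if there are arbitrarily large finite separated
  sets, and \<open>span\<close> is \<open>\<infinity>\<close> if there is no finite spanning set. If \<open>X\<close> is compact and \<open>\<epsilon> > 0\<close>, both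
  are finite, and the supremum and infimum are a maximum and a minimum.
\<close>

definition sep_num :: "'a set \<Rightarrow> real \<Rightarrow> ('a \<Rightarrow> 'a \<Rightarrow> real) \<Rightarrow> enat" where
  "sep_num X \<epsilon> \<mu> = (SUP S\<in>{S. finite S \<and> S \<subseteq> X \<and> separated S \<epsilon> \<mu>}. enat (card S))"

definition span_num :: "'a set \<Rightarrow> real \<Rightarrow> ('a \<Rightarrow> 'a \<Rightarrow> real) \<Rightarrow> enat" where
  "span_num X \<epsilon> \<mu> = (INF S\<in>{S. finite S \<and> spanning X S \<epsilon> \<mu>}. enat (card S))"

text \<open>The value at \<open>0\<close>, which only arises for the empty space, is \<open>ln 0 = 0\<close>.\<close>

definition ln_enat :: "enat \<Rightarrow> ereal" where
  "ln_enat n = (case n of enat k \<Rightarrow> ereal (ln (real k)) | \<infinity> \<Rightarrow> \<infinity>)"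

definition span_rate ::
    "'a set \<Rightarrow> ('a \<Rightarrow> 'a \<Rightarrow> real) \<Rightarrow> ('a \<Rightarrow> 'a) \<Rightarrow> real \<Rightarrow> nat \<Rightarrow> ereal" where
  "span_rate X D F \<epsilon> T = ln_enat (span_num X \<epsilon> (dyn_dist D F T)) / ereal (real T)"

definition sep_rate ::
    "'a set \<Rightarrow> ('a \<Rightarrow> 'a \<Rightarrow> real) \<Rightarrow> ('a \<Rightarrow> 'a) \<Rightarrow> real \<Rightarrow> nat \<Rightarrow> ereal" where
  "sep_rate X D F \<epsilon> T = ln_enat (sep_num X \<epsilon> (dyn_dist D F T)) / ereal (real T)"

definition topological_entropy ::
    "'a set \<Rightarrow> ('a \<Rightarrow> 'a \<Rightarrow> real) \<Rightarrow> ('a \<Rightarrow> 'a) \<Rightarrow> ereal" where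
  "topological_entropy X D F = Lim (at_right 0) (\<lambda>\<epsilon>. limsup (\<lambda>T. span_rate X D F \<epsilon> T))"

text \<open>The limit defining the entropy always exists, by monotonicity in \<open>\<epsilon>\<close>.\<close>

lemma ln_enat_mono:
  assumes "m \<le> n"
  shows "ln_enat m \<le> ln_enat n"
proof (cases m; cases n)
  fix i j assume "m = enat i" "n = enat j"
  with assms show ?thesis
    by (cases "i = 0"; cases "j = 0") (auto simp: ln_enat_def)
qed (use assms in \<open>auto simp: ln_enat_def\<close>)

lemma span_num_antimono: "\<epsilon> \<le> \<delta> \<Longrightarrow> span_num X \<delta> \<mu> \<le> span_num X \<epsilon> \<mu>"
  unfolding span_num_def spanning_def
  by (intro INF_superset_mono) (blast intro: less_le_trans order_refl)+

lemma span_rate_antimono: "\<epsilon> \<le> \<delta> \<Longrightarrow> span_rate X D F \<delta> T \<le> span_rate X D F \<epsilon> T"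
  unfolding span_rate_def divide_ereal_def
  by (intro ereal_mult_right_mono ln_enat_mono span_num_antimono) auto

lemma limsup_span_rate_antimono:
  "\<epsilon> \<le> \<delta> \<Longrightarrow> limsup (span_rate X D F \<delta>) \<le> limsup (span_rate X D F \<epsilon>)"
  by (intro Limsup_mono always_eventually allI span_rate_antimono)

lemma topological_entropy_tendsto:
  "((\<lambda>\<epsilon>. limsup (span_rate X D F \<epsilon>)) \<longlongrightarrow> topological_entropy X D F) (at_right 0)"
proof -
  let ?f = "\<lambda>\<epsilon>. limsup (span_rate X D F \<epsilon>)"
  have "(?f \<longlongrightarrow> (SUP \<epsilon>\<in>{0<..}. ?f \<epsilon>)) (at_right 0)"
  proof (rule increasing_tendsto)
    show "\<forall>\<^sub>F \<epsilon> in at_right 0. ?f \<epsilon> \<le> (SUP \<epsilon>\<in>{0<..}. ?f \<epsilon>)"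
      by (auto simp: eventually_at_filter intro!: always_eventually SUP_upper)
  next
    fix a assume "a < (SUP \<epsilon>\<in>{0<..}. ?f \<epsilon>)"
    then obtain \<delta> where \<delta>: "\<delta> > 0" "a < ?f \<delta>"
      by (auto simp: less_SUP_iff)
    have "\<forall>\<^sub>F \<epsilon> in at_right 0. \<epsilon> < \<delta>"
      using \<delta>(1) eventually_at_right_field by blast
    then show "\<forall>\<^sub>F \<epsilon> in at_right 0. a < ?f \<epsilon>"
      by eventually_elim (use \<delta>(2) limsup_span_rate_antimono less_le_trans less_imp_le in metis)
  qed
  then show ?thesis
    by (simp add: topological_entropy_def tendsto_Lim)
qed

end

theory Submission
  imports Defs "HOL-Library.Nat_Bijection"
begin

text \<open>
  The system is a subshift: bi-infinite sequences over a blank \<open>0\<close> and five digits \<open>1, \<dots>, 5\<close>, under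
  the shift. The metric is chosen so that at the critical scale \<open>\<epsilon> = 2\<close> one time step separates two
  points only under a demanding closed condition: either exactly one of the two
  current cells is blank, or the current digits are neighbours in a five-cycle \<open>C\<^sub>5\<close> and the two
  sequences agree all the way back to the last blank. So within a run of digits only the first
  difference of two sequences can separate them, and it does so only if it is an edge of \<open>C\<^sub>5\<close>.

  Since \<open>C\<^sub>5\<close> has no triangle, each digit of a run multiplies the size of a separated set by at most
  \<open>2\<close>, although there are five digits (\<open>card_le_power_of_first_difference\<close>). On the other hand \<open>C\<^sub>5\<close>
  is self-complementary: doubling modulo five turns non-edges into edges. Hence two different words
  \<open>v, v'\<close> of equal length are always separated by their own digits or by the doubled ones. The
  words \<open>v \<Box> (2v)\<close>, with \<open>v\<close> of length \<open>4M\<close> and \<open>M\<close> blanks \<open>\<Box>\<close> in between, therefore form a family of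
  \<open>5\<^bsup>4M\<^esup>\<close> words of length \<open>9M\<close> that are pairwise separated.

  The system consists of the sequences with at most one run of digits, together with those that carry
  one word \<open>v \<Box> (2v)\<close> with \<open>M = 20\<^sup>k\<close> for some \<open>k\<close> and are blank elsewhere.

  At time \<open>9 \<cdot> 20\<^sup>k\<close> the words of scale \<open>k\<close> are seen completely. The blanks in the middle force any
  nearby point to be such a word too, and then to be the same word, so that a spanning set
  has at least \<open>5\<close> to the power \<open>4 \<cdot> 20\<^sup>k\<close> elements (\<open>span_num_system_ge\<close>).

  At time \<open>T = 20\<^sup>k\<close> the two copies of a word of scale \<open>\<ge> k\<close> are too far apart to meet the same
  window, so only one of them is seen and contributes at most \<open>2\<^sup>T\<close>; the words of smaller
  scales carry so few digits that they contribute no more. There are polynomially many ways to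
  distribute blanks over the window, so a separated set has at most \<open>(2T)\<^sup>4 2\<^sup>T\<close> elements
  (\<open>sep_num_system_le\<close>).

  Since spanning numbers are at most separation numbers, both lower limits are at most \<open>ln 2\<close>
  and both upper limits are at least \<open>(4 ln 5) / 9\<close>. The latter is larger because \<open>2\<^sup>9 = 512 < 625 = 5\<^sup>4\<close>.
  The entropy is at most \<open>ln 6\<close>, as there are six letters.
\<close>

section \<open>Spanning and separated sets\<close>

lemma dyn_dist_ge_iff:
  "T \<ge> 1 \<Longrightarrow> \<epsilon> \<le> dyn_dist D F T x y \<longleftrightarrow> (\<exists>t<T. \<epsilon> \<le> D ((F ^^ t) x) ((F ^^ t) y))"
  unfolding dyn_dist_def by (subst Max_ge_iff) auto

lemma dyn_dist_less_iff:
  "T \<ge> 1 \<Longrightarrow> dyn_dist D F T x y < \<epsilon> \<longleftrightarrow> (\<forall>t<T. D ((F ^^ t) x) ((F ^^ t) y) < \<epsilon>)"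
  using dyn_dist_ge_iff[of T \<epsilon> D F x y] by (meson not_le)

text \<open>
  One point from each fibre of \<open>f\<close> gives a spanning set.
\<close>

lemma span_num_le_card:
  assumes "finite Y" "f ` X \<subseteq> Y" "\<And>x y. x \<in> X \<Longrightarrow> y \<in> X \<Longrightarrow> f x = f y \<Longrightarrow> \<mu> x y < \<epsilon>"
  shows "span_num X \<epsilon> \<mu> \<le> enat (card Y)"
proof -
  define S where "S = inv_into X f ` f ` X"
  have fin: "finite (f ` X)" using assms finite_subset by blast
  have "spanning X S \<epsilon> \<mu>"
    unfolding spanning_def
  proof (intro conjI ballI)
    show "S \<subseteq> X" by (auto simp: S_def inv_into_into)
    fix x assume x: "x \<in> X"
    have "\<mu> (inv_into X f (f x)) x < \<epsilon>"
      using x by (intro assms(3)) (auto simp: inv_into_into f_inv_into_f)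
    then show "\<exists>s\<in>S. \<mu> s x < \<epsilon>" using x by (auto simp: S_def)
  qed
  moreover have "finite S" using fin by (simp add: S_def)
  ultimately have "span_num X \<epsilon> \<mu> \<le> enat (card S)"
    unfolding span_num_def by (intro INF_lower) auto
  also have "card S \<le> card Y"
    unfolding S_def using fin assms(1,2) by (meson card_image_le card_mono le_trans)
  finally show ?thesis by simp
qed

text \<open>
  A separated set of maximal size is spanning, for any point that it misses could be added.
\<close>

lemma span_num_le_sep_num:
  assumes "\<And>x. x \<in> X \<Longrightarrow> \<mu> x x < \<epsilon>" "\<And>x y. \<mu> x y = \<mu> y x"
  shows "span_num X \<epsilon> \<mu> \<le> sep_num X \<epsilon> \<mu>"
proof (cases "sep_num X \<epsilon> \<mu>")
  case (enat n)
  define P where "P = (\<lambda>S. finite S \<and> S \<subseteq> X \<and> separated S \<epsilon> \<mu>)"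
  have bound: "card S \<le> n" if "P S" for S
    using that enat SUP_upper[of S "{S. finite S \<and> S \<subseteq> X \<and> separated S \<epsilon> \<mu>}" "\<lambda>S. enat (card S)"]
    by (auto simp: P_def sep_num_def)
  have "P {}" by (simp add: P_def separated_def)
  moreover have "\<forall>S. P S \<longrightarrow> card S < Suc n" using bound by (simp add: less_Suc_eq_le)
  ultimately have "\<exists>S. P S \<and> (\<forall>S'. P S' \<longrightarrow> card S' \<le> card S)"
    by (rule ex_has_greatest_nat)
  then obtain S where S: "P S" "\<And>S'. P S' \<Longrightarrow> card S' \<le> card S" by blast
  have "spanning X S \<epsilon> \<mu>"
    unfolding spanning_def
  proof (intro conjI ballI)
    show "S \<subseteq> X" using S by (simp add: P_def)
    fix x assume x: "x \<in> X"
    show "\<exists>s\<in>S. \<mu> s x < \<epsilon>"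
    proof (rule ccontr)
      assume none: "\<not> (\<exists>s\<in>S. \<mu> s x < \<epsilon>)"
      then have "x \<notin> S" using assms(1) x by blast
      moreover have "P (insert x S)"
        using S(1) x none assms(2) unfolding P_def separated_def by (auto simp: not_less)
      ultimately show False using S(2)[of "insert x S"] S(1) by (auto simp: P_def)
    qed
  qed
  then have "span_num X \<epsilon> \<mu> \<le> enat (card S)"
    using S(1) unfolding span_num_def P_def by (intro INF_lower) auto
  also have "\<dots> \<le> sep_num X \<epsilon> \<mu>"
    using S(1) unfolding sep_num_def P_def by (intro SUP_upper) auto
  finally show ?thesis .
qed auto

section \<open>The five-cycle\<close>

text \<open>
  The digits are residues modulo five, with \<open>5\<close> for the residue zero. Edges of the five-cycle join
  residues that differ by \<open>2\<close> or \<open>3\<close>, and doubling maps the differences \<open>1, 4\<close> to \<open>2, 3\<close>.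
\<close>

definition adjacent :: "real \<Rightarrow> real \<Rightarrow> bool" where
  "adjacent a b \<longleftrightarrow> \<bar>a - b\<bar> \<in> {2, 3}"

definition double :: "real \<Rightarrow> real" where
  "double a = (if a \<le> 2 then 2 * a else 2 * a - 5)"

abbreviation digits :: "real set" where
  "digits \<equiv> {1, 2, 3, 4, 5}"

lemma adjacent_sym: "adjacent a b \<longleftrightarrow> adjacent b a"
  by (simp add: adjacent_def abs_minus_commute)

text \<open>
  Of three reals that are pairwise at least \<open>2\<close> apart, the extreme ones are at least \<open>4\<close> apart.
\<close>

lemma adjacent_triangle_free:
  assumes "adjacent a b" "adjacent b c"
  shows "\<not> adjacent a c"
proof
  assume "adjacent a c"
  then have "2 \<le> \<bar>a - b\<bar>" "2 \<le> \<bar>b - c\<bar>" "2 \<le> \<bar>a - c\<bar>"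
    and "\<bar>a - b\<bar> \<le> 3" "\<bar>b - c\<bar> \<le> 3" "\<bar>a - c\<bar> \<le> 3"
    using assms by (auto simp: adjacent_def)
  then show False by linarith
qed

lemma adjacent_or_adjacent_double:
  assumes "a \<in> digits" "b \<in> digits" "a \<noteq> b"
  shows "adjacent a b \<or> adjacent (double a) (double b)"
  using assms unfolding adjacent_def double_def by (elim insertE emptyE; simp)

lemma double_digits: "a \<in> digits \<Longrightarrow> double a \<in> digits"
  by (auto simp: double_def)

text \<open>
  Sequences that are pairwise adjacent at their first difference use at most two values
  at the first position, as these are pairwise adjacent. The sequences that share one of these values
  satisfy the same hypothesis after their first entry is removed.
\<close>

lemma card_le_power_of_first_difference:
  fixes f :: "'a \<Rightarrow> nat \<Rightarrow> real"
  assumes "finite K"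
    and "\<And>x y. x \<in> K \<Longrightarrow> y \<in> K \<Longrightarrow> x \<noteq> y \<Longrightarrow>
      \<exists>t<b. adjacent (f x t) (f y t) \<and> (\<forall>j<t. f x j = f y j)"
  shows "card K \<le> 2 ^ b"
  using assms
proof (induction b arbitrary: f K)
  case 0
  then have "\<And>x y. x \<in> K \<Longrightarrow> y \<in> K \<Longrightarrow> x = y" by blast
  then show ?case by (simp add: card_le_Suc0_iff_eq 0)
next
  case (Suc b)
  define A where "A = (\<lambda>x. f x 0) ` K"
  have A: "finite A" using Suc.prems by (auto simp: A_def)
  have adj: "adjacent a a'" if "a \<in> A" "a' \<in> A" "a \<noteq> a'" for a a'
  proof -
    from that obtain x y where xy: "x \<in> K" "y \<in> K" "a = f x 0" "a' = f y 0" by (auto simp: A_def)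
    moreover from this have "x \<noteq> y" using that by auto
    ultimately obtain t where "adjacent (f x t) (f y t)" "\<forall>j<t. f x j = f y j"
      using Suc.prems(2)[of x y] by blast
    moreover from this have "t = 0" using that xy by (metis gr0I)
    ultimately show ?thesis using xy by simp
  qed
  have "card A \<le> 2"
  proof (rule ccontr)
    assume "\<not> card A \<le> 2"
    then have "3 \<le> card A" by simp
    then obtain B where "B \<subseteq> A" "card B = 3" using obtain_subset_with_card_n by metis
    then obtain a b c where "a \<in> A" "b \<in> A" "c \<in> A" "a \<noteq> b" "b \<noteq> c" "a \<noteq> c"
      by (auto simp: card_3_iff)
    then show False using adj adjacent_triangle_free[of a b c] by blast
  qed
  have fibre: "card {x\<in>K. f x 0 = a} \<le> 2 ^ b" for a
  proof (rule Suc.IH[of _ "\<lambda>x i. f x (Suc i)"])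
    fix x y assume "x \<in> {x\<in>K. f x 0 = a}" "y \<in> {x\<in>K. f x 0 = a}" "x \<noteq> y"
    then obtain t where t: "t < Suc b" "adjacent (f x t) (f y t)" "\<forall>j<t. f x j = f y j"
      and eq: "f x 0 = f y 0"
      using Suc.prems(2)[of x y] by auto
    from t eq obtain s where "t = Suc s" by (cases t) (auto simp: adjacent_def)
    with t show "\<exists>t<b. adjacent (f x (Suc t)) (f y (Suc t)) \<and> (\<forall>j<t. f x (Suc j) = f y (Suc j))"
      by auto
  qed (use Suc.prems in auto)
  have "K = (\<Union>a\<in>A. {x\<in>K. f x 0 = a})" by (auto simp: A_def)
  then have "card K \<le> (\<Sum>a\<in>A. card {x\<in>K. f x 0 = a})"
    using card_UN_le[OF A, of "\<lambda>a. {x\<in>K. f x 0 = a}"] by simp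
  also have "\<dots> \<le> (\<Sum>a\<in>A. 2 ^ b)" by (rule sum_mono) (rule fibre)
  also have "\<dots> = card A * 2 ^ b" by simp
  also have "\<dots> \<le> 2 ^ Suc b" using \<open>card A \<le> 2\<close> by simp
  finally show ?case .
qed

section \<open>Sequences and their metric\<close>

text \<open>
  Bi-infinite sequences are encoded as functions on the natural numbers, through the
  bijection between integers and naturals; \<open>cell\<close> reads off the entry at an integer position.
\<close>

definition cell :: "(nat \<Rightarrow> real) \<Rightarrow> int \<Rightarrow> real" where
  "cell x i = x (int_encode i)"

definition shift :: "(nat \<Rightarrow> real) \<Rightarrow> nat \<Rightarrow> real" where
  "shift x = (\<lambda>n. x (int_encode (int_decode n + 1)))"

lemma cell_shift [simp]: "cell (shift x) i = cell x (i + 1)"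
  by (simp add: cell_def shift_def)

lemma cell_funpow_shift [simp]: "cell ((shift ^^ t) x) i = cell x (i + int t)"
  by (induction t arbitrary: i) (auto simp: algebra_simps)

lemma cell_eqI: "(\<And>i. cell x i = cell y i) \<Longrightarrow> x = y"
  by (rule ext) (metis cell_def int_decode_inverse)

text \<open>
  With \<open>P\<close> as disagreement at distance \<open>n\<close> this is the usual ultrametric on sequences. The same function
  measures below how far a pair of points stays from the critical distance.
\<close>

definition weight :: "(nat \<Rightarrow> bool) \<Rightarrow> real" where
  "weight P = (if \<exists>n. P n then (1/2) ^ (LEAST n. P n) else 0)"

lemma weight_nonneg: "0 \<le> weight P"
  by (simp add: weight_def)

lemma weight_le:
  assumes "\<And>n. n < N \<Longrightarrow> \<not> P n"
  shows "weight P \<le> (1/2) ^ N"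
proof (cases "\<exists>n. P n")
  case True
  then have "P (LEAST n. P n)" by (rule LeastI_ex)
  then have "N \<le> (LEAST n. P n)" using assms not_less by blast
  then show ?thesis using True by (simp add: weight_def power_decreasing)
qed (simp add: weight_def)

lemma weight_ge: "P n \<Longrightarrow> (1/2) ^ n \<le> weight P"
  by (auto simp: weight_def Least_le intro!: power_decreasing)

lemma weight_eq_0_iff: "weight P = 0 \<longleftrightarrow> (\<forall>n. \<not> P n)"
  by (auto simp: weight_def)

lemma weight_subadditive:
  assumes "\<And>n. P n \<Longrightarrow> Q n \<or> R n"
  shows "weight P \<le> weight Q + weight R"
proof (cases "\<exists>n. P n")
  case True
  define n where "n = (LEAST n. P n)"
  have "P n" unfolding n_def using True by (rule LeastI_ex)
  then have "Q n \<or> R n" by (rule assms)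
  then have "(1/2) ^ n \<le> weight Q + weight R"
    using weight_ge[of Q n] weight_ge[of R n] weight_nonneg[of Q] weight_nonneg[of R] by auto
  then show ?thesis using True by (simp add: weight_def n_def)
qed (use weight_nonneg[of Q] weight_nonneg[of R] in \<open>simp add: weight_def\<close>)

text \<open>
  If the first \<open>P\<close> comes before any error \<open>E\<close>, then \<open>Q\<close> holds there as well; otherwise the error comes first
  and outweighs \<open>P\<close>. This yields the triangle inequality, with disagreement of two points as error.
\<close>

lemma weight_perturb:
  assumes "\<And>n. (\<And>j. j \<le> n \<Longrightarrow> \<not> E j) \<Longrightarrow> P n \<Longrightarrow> Q n"
  shows "weight P \<le> weight Q + weight E"
proof (cases "\<exists>n. P n")
  case True
  define n where "n = (LEAST n. P n)"
  have n: "P n" unfolding n_def using True by (rule LeastI_ex)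
  have "(1/2) ^ n \<le> weight Q + weight E"
  proof (cases "\<exists>j\<le>n. E j")
    case True
    then obtain j where j: "j \<le> n" "E j" by blast
    have "(1/2::real) ^ n \<le> (1/2) ^ j" using j by (simp add: power_decreasing)
    then show ?thesis using weight_ge[of E j] j weight_nonneg[of Q] by linarith
  next
    case False
    then have "Q n" using assms n by blast
    then show ?thesis using weight_ge[of Q n] weight_nonneg[of E] by linarith
  qed
  then show ?thesis using True by (simp add: weight_def n_def)
qed (use weight_nonneg[of Q] weight_nonneg[of E] in \<open>simp add: weight_def\<close>)

definition differ :: "(nat \<Rightarrow> real) \<Rightarrow> (nat \<Rightarrow> real) \<Rightarrow> nat \<Rightarrow> bool" where
  "differ x y n \<longleftrightarrow> cell x (int n) \<noteq> cell y (int n) \<or> cell x (- int n) \<noteq> cell y (- int n)"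

text \<open>
  Blanks erase the memory of the past, so that the second copy of a word can start afresh: only a
  difference in the current run of digits, or in the cell before it, prevents a separation.
\<close>

definition prior :: "(nat \<Rightarrow> real) \<Rightarrow> (nat \<Rightarrow> real) \<Rightarrow> nat \<Rightarrow> bool" where
  "prior x y n \<longleftrightarrow> 0 < n \<and> cell x (- int n) \<noteq> cell y (- int n) \<and>
    (\<forall>j. 0 < j \<and> j < n \<longrightarrow> cell x (- int j) \<noteq> 0 \<and> cell y (- int j) \<noteq> 0)"

text \<open>
  Points with different current cells have distance at least \<open>1\<close>, points with equal current cells
  have the usual product distance, at most \<open>1/2\<close>. For adjacent digits, \<open>2 - weight (prior x y)\<close> makes
  the distance continuous, while the value \<open>2\<close> is attained only if there is no prior
  difference at all. So the relation \<open>2 \<le> dist_seq x y\<close> depends on infinitely many cells.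
\<close>

definition dist_seq :: "(nat \<Rightarrow> real) \<Rightarrow> (nat \<Rightarrow> real) \<Rightarrow> real" where
  "dist_seq x y =
    (if cell x 0 = cell y 0 then weight (differ x y)
     else if cell x 0 = 0 \<or> cell y 0 = 0 then 2
     else if adjacent (cell x 0) (cell y 0) then 2 - weight (prior x y)
     else 1)"

lemma differ_sym: "differ x y = differ y x"
  by (auto simp: differ_def fun_eq_iff)

lemma differ_cases: "differ x z n \<Longrightarrow> differ x y n \<or> differ y z n"
  by (auto simp: differ_def)

lemma prior_sym: "prior x y = prior y x"
  by (auto simp: prior_def fun_eq_iff)

lemma dist_seq_le_half: "cell x 0 = cell y 0 \<Longrightarrow> dist_seq x y \<le> 1/2"
  using weight_le[of 1 "differ x y"] by (simp add: dist_seq_def differ_def)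

lemma weight_prior_le_half: "weight (prior x y) \<le> 1/2"
  using weight_le[of 1 "prior x y"] by (simp add: prior_def)

lemma dist_seq_ge_1: "cell x 0 \<noteq> cell y 0 \<Longrightarrow> 1 \<le> dist_seq x y"
  using weight_prior_le_half[of x y] by (simp add: dist_seq_def)

lemma dist_seq_le_2: "dist_seq x y \<le> 2"
  using dist_seq_le_half[of x y] weight_nonneg[of "prior x y"]
  by (cases "cell x 0 = cell y 0") (auto simp: dist_seq_def)

lemma dist_seq_sym: "dist_seq x y = dist_seq y x"
  using differ_sym[of x y] prior_sym[of x y] adjacent_sym by (auto simp: dist_seq_def)

lemma dist_seq_ge_2_iff:
  "2 \<le> dist_seq x y \<longleftrightarrow> cell x 0 \<noteq> cell y 0 \<and>
    (cell x 0 = 0 \<or> cell y 0 = 0 \<or> (adjacent (cell x 0) (cell y 0) \<and> (\<forall>n. \<not> prior x y n)))"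
  using dist_seq_le_half[of x y] weight_nonneg[of "prior x y"] weight_eq_0_iff[of "prior x y"]
  by (auto simp: dist_seq_def)

text \<open>
  The one delicate case of the triangle inequality: replacing \<open>y\<close> by a point \<open>x\<close> with the same current cell
  changes the prior differences with \<open>z\<close> only from the first disagreement of \<open>x\<close> and \<open>y\<close> on.
\<close>

lemma dist_seq_perturb:
  assumes "cell x 0 = cell y 0" "cell x 0 \<noteq> cell z 0"
  shows "dist_seq x z \<le> dist_seq y z + dist_seq x y"
proof -
  have "weight (prior y z) \<le> weight (prior x z) + weight (differ x y)"
  proof (rule weight_perturb)
    fix n assume eq: "\<And>j. j \<le> n \<Longrightarrow> \<not> differ x y j" and "prior y z n"
    moreover have "cell x (- int j) = cell y (- int j)" if "j \<le> n" for j
      using eq[OF that] by (simp add: differ_def)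
    ultimately show "prior x z n" by (auto simp: prior_def)
  qed
  then show ?thesis
    using assms weight_nonneg[of "differ x y"] by (auto simp: dist_seq_def)
qed

lemma Metric_space_dist_seq: "Metric_space X dist_seq"
proof
  show "0 \<le> dist_seq x y" for x y
    using weight_nonneg[of "differ x y"] dist_seq_ge_1[of x y]
    by (cases "cell x 0 = cell y 0") (auto simp: dist_seq_def)
  show "dist_seq x y = dist_seq y x" for x y
    by (rule dist_seq_sym)
  show "dist_seq x y = 0 \<longleftrightarrow> x = y" for x y
  proof
    assume eq: "dist_seq x y = 0"
    then have "cell x 0 = cell y 0" using dist_seq_ge_1[of x y] by force
    then have no: "\<not> differ x y n" for n using eq weight_eq_0_iff by (simp add: dist_seq_def)
    show "x = y"
    proof (rule cell_eqI)
      fix i :: int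
      show "cell x i = cell y i" using no[of "nat \<bar>i\<bar>"] by (cases "i \<ge> 0") (auto simp: differ_def)
    qed
  qed (simp add: dist_seq_def weight_eq_0_iff differ_def)
  show "dist_seq x z \<le> dist_seq x y + dist_seq y z" for x y z
  proof -
    consider "cell x 0 = cell y 0" "cell y 0 = cell z 0"
      | "cell x 0 = cell y 0" "cell x 0 \<noteq> cell z 0"
      | "cell y 0 = cell z 0" "cell x 0 \<noteq> cell z 0"
      | "cell x 0 \<noteq> cell y 0" "cell y 0 \<noteq> cell z 0" by argo
    then show ?thesis
    proof cases
      case 1
      then show ?thesis
        using weight_subadditive[of "differ x z" "differ x y" "differ y z", OF differ_cases]
        by (simp add: dist_seq_def)
    next
      case 2
      then show ?thesis using dist_seq_perturb[of x y z] by linarith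
    next
      case 3
      then show ?thesis
        using dist_seq_perturb[of z y x] dist_seq_sym[of x y] dist_seq_sym[of y z] dist_seq_sym[of x z]
        by (metis add.commute)
    next
      case 4
      then show ?thesis
        using dist_seq_ge_1[of x y] dist_seq_ge_1[of y z] dist_seq_le_2[of x z] by linarith
    qed
  qed
qed

lemma dist_seq_le_power:
  assumes "\<And>i. \<bar>i\<bar> \<le> int N \<Longrightarrow> cell x i = cell y i"
  shows "dist_seq x y \<le> (1/2) ^ N"
proof -
  have "weight (differ x y) \<le> (1/2) ^ N"
    by (rule weight_le) (auto simp: differ_def assms)
  then show ?thesis using assms[of 0] by (simp add: dist_seq_def)
qed

lemma dist_seq_less_power_imp_eq:
  assumes "dist_seq x y < (1/2) ^ N" "\<bar>i\<bar> \<le> int N"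
  shows "cell x i = cell y i"
proof (rule ccontr)
  assume ne: "cell x i \<noteq> cell y i"
  have "(1/2::real) ^ N \<le> 1" by (simp add: power_le_one)
  then have 0: "cell x 0 = cell y 0" using assms dist_seq_ge_1[of x y] by force
  have "differ x y (nat \<bar>i\<bar>)" using ne by (cases "i \<ge> 0") (auto simp: differ_def)
  then have "(1/2) ^ nat \<bar>i\<bar> \<le> dist_seq x y" using weight_ge 0 by (simp add: dist_seq_def)
  moreover have "(1/2::real) ^ N \<le> (1/2) ^ nat \<bar>i\<bar>"
    using assms(2) by (intro power_decreasing) auto
  ultimately show False using assms(1) by linarith
qed

text \<open>
  Distance \<open>2\<close> after moving the origin to position \<open>t\<close>, expressed in absolute positions.
\<close>

definition separates :: "(nat \<Rightarrow> real) \<Rightarrow> (nat \<Rightarrow> real) \<Rightarrow> int \<Rightarrow> bool" where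
  "separates x y t \<longleftrightarrow> cell x t \<noteq> cell y t \<and>
    (cell x t = 0 \<or> cell y t = 0 \<or>
     adjacent (cell x t) (cell y t) \<and>
     (\<forall>s<t. (\<forall>j. s < j \<and> j < t \<longrightarrow> cell x j \<noteq> 0 \<and> cell y j \<noteq> 0) \<longrightarrow> cell x s = cell y s))"

lemma all_prior_iff:
  "(\<forall>n. \<not> prior ((shift ^^ t) x) ((shift ^^ t) y) n) \<longleftrightarrow>
    (\<forall>s<int t. (\<forall>j. s < j \<and> j < int t \<longrightarrow> cell x j \<noteq> 0 \<and> cell y j \<noteq> 0) \<longrightarrow> cell x s = cell y s)"
  (is "?L \<longleftrightarrow> ?R")
proof
  assume L: ?L
  show ?R
  proof (intro allI impI)
    fix s assume s: "s < int t"
      and run: "\<forall>j. s < j \<and> j < int t \<longrightarrow> cell x j \<noteq> 0 \<and> cell y j \<noteq> 0"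
    define n where "n = nat (int t - s)"
    have n: "int t - int n = s" "0 < n" using s by (simp_all add: n_def)
    have "\<not> prior ((shift ^^ t) x) ((shift ^^ t) y) n" using L by blast
    moreover have "cell x (int t - int j) \<noteq> 0 \<and> cell y (int t - int j) \<noteq> 0" if "0 < j" "j < n" for j
      using run n that by simp
    ultimately show "cell x s = cell y s" using n by (auto simp: prior_def)
  qed
next
  assume R: ?R
  show ?L
  proof (intro allI notI)
    fix n assume p: "prior ((shift ^^ t) x) ((shift ^^ t) y) n"
    then have "0 < n" "cell x (int t - int n) \<noteq> cell y (int t - int n)" by (auto simp: prior_def)
    moreover have "cell x j \<noteq> 0 \<and> cell y j \<noteq> 0" if "int t - int n < j" "j < int t" for j
    proof -
      have "0 < nat (int t - j)" "nat (int t - j) < n" using that by auto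
      moreover have "- int (nat (int t - j)) + int t = j" using that by simp
      ultimately show ?thesis using p unfolding prior_def cell_funpow_shift by metis
    qed
    ultimately show False using R[rule_format, of "int t - int n"] by simp
  qed
qed

lemma dyn_dist_ge_2_iff:
  assumes "T \<ge> 1"
  shows "2 \<le> dyn_dist dist_seq shift T x y \<longleftrightarrow> (\<exists>t<T. separates x y (int t))"
  unfolding dyn_dist_ge_iff[OF assms] dist_seq_ge_2_iff separates_def all_prior_iff
  by simp

section \<open>The subshift\<close>

definition gap :: "(nat \<Rightarrow> real) \<Rightarrow> int \<Rightarrow> int \<Rightarrow> bool" where
  "gap x a b \<longleftrightarrow> a + 1 < b \<and> cell x a \<noteq> 0 \<and> cell x b \<noteq> 0 \<and> (\<forall>i. a < i \<and> i < b \<longrightarrow> cell x i = 0)"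

text \<open>
  The doubled copy separates the words that the first copy fails to separate. The \<open>M\<close> blanks in
  between keep the two copies from being visible in a common window of length \<open>M\<close>.
\<close>

definition paired :: "int \<Rightarrow> int \<Rightarrow> (nat \<Rightarrow> real) \<Rightarrow> bool" where
  "paired M p x \<longleftrightarrow>
    (\<forall>i. cell x i \<noteq> 0 \<longleftrightarrow> i \<in> {p..<p + 4 * M} \<union> {p + 5 * M..<p + 9 * M}) \<and>
    (\<forall>i. p \<le> i \<and> i < p + 4 * M \<longrightarrow> cell x (i + 5 * M) = double (cell x i))"

text \<open>
  Membership is stated as a condition on gaps, so that sequences with a single run of digits, possibly
  infinite, are included. Compactness needs the infinite runs: these are the limits of paired
  sequences as the scale tends to infinity. The length of a gap determines \<open>k\<close>.
\<close>

definition system :: "(nat \<Rightarrow> real) set" where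
  "system = {x. (\<forall>i. cell x i \<in> insert 0 digits) \<and>
    (\<forall>a b. gap x a b \<longrightarrow> (\<exists>k::nat. b = a + 20 ^ k + 1 \<and> paired (20 ^ k) (a + 1 - 4 * 20 ^ k) x))}"

lemma system_letters: "x \<in> system \<Longrightarrow> cell x i \<in> insert 0 digits"
  unfolding system_def by blast

lemma system_gapE:
  assumes "x \<in> system" "gap x a b"
  obtains k :: nat where "b = a + 20 ^ k + 1" "paired (20 ^ k) (a + 1 - 4 * 20 ^ k) x"
  using assms unfolding system_def by blast

text \<open>
  The system is closed in the product topology. A gap of \<open>x\<close> is visible in a finite window and fixes the scale
  and the position of the pair; the rest of the condition concerns one or two cells at a time.
\<close>

lemma systemI_local:
  assumes "\<And>I. finite I \<Longrightarrow> \<exists>y\<in>system. \<forall>i\<in>I. cell y i = cell x i"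
  shows "x \<in> system"
  unfolding system_def
proof (intro CollectI conjI allI impI)
  fix i
  show "cell x i \<in> insert 0 digits"
    using assms[of "{i}"] system_letters by (metis finite.emptyI finite.insertI insertI1)
next
  fix a b assume gap: "gap x a b"
  have gap_agree: "gap y a b" if "\<forall>i\<in>{a..b}. cell y i = cell x i" for y
    using gap that unfolding gap_def by auto
  from assms[of "{a..b}"] obtain y where "y \<in> system" "gap y a b"
    using gap_agree by auto
  then obtain k :: nat where k: "b = a + 20 ^ k + 1" unfolding system_def by blast
  let ?M = "20 ^ k :: int" and ?p = "a + 1 - 4 * 20 ^ k :: int"
  have paired: "\<exists>y. paired ?M ?p y \<and> (\<forall>i\<in>I. cell y i = cell x i)" if I: "finite I" for I
  proof -
    from assms[of "{a..b} \<union> I"] I obtain y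
      where y: "y \<in> system" "\<forall>i\<in>{a..b} \<union> I. cell y i = cell x i" by auto
    then have "gap y a b" using gap_agree by auto
    then obtain k' :: nat where "b = a + 20 ^ k' + 1" "paired (20 ^ k') (a + 1 - 4 * 20 ^ k') y"
      using y(1) unfolding system_def by blast
    moreover from this k have "k' = k" by simp
    ultimately show ?thesis using y(2) by blast
  qed
  have "paired ?M ?p x"
    unfolding paired_def
  proof (intro conjI allI impI)
    fix i
    show "cell x i \<noteq> 0 \<longleftrightarrow> i \<in> {?p..<?p + 4 * ?M} \<union> {?p + 5 * ?M..<?p + 9 * ?M}"
      using paired[of "{i}"] unfolding paired_def by (metis finite.emptyI finite.insertI singletonI)
  next
    fix i assume i: "?p \<le> i \<and> i < ?p + 4 * ?M"
    obtain y where "paired ?M ?p y" "cell y i = cell x i" "cell y (i + 5 * ?M) = cell x (i + 5 * ?M)"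
      using paired[of "{i, i + 5 * ?M}"] by auto
    then show "cell x (i + 5 * ?M) = double (cell x i)"
      using i unfolding paired_def by metis
  qed
  with k show "\<exists>k::nat. b = a + 20 ^ k + 1 \<and> paired (20 ^ k) (a + 1 - 4 * 20 ^ k) x" by blast
qed

lemma open_cylinder: "finite I \<Longrightarrow> open {y. \<forall>i\<in>I. \<bar>cell y i - cell x i\<bar> < 1/2}"
proof -
  assume I: "finite I"
  have "open {y. \<bar>cell y i - cell x i\<bar> < 1/2}" for i
    unfolding cell_def by (intro open_Collect_less continuous_intros continuous_on_product_coordinates)
  then have "open (\<Inter>i\<in>I. {y. \<bar>cell y i - cell x i\<bar> < 1/2})"
    using I by (intro open_INT) auto
  also have "(\<Inter>i\<in>I. {y. \<bar>cell y i - cell x i\<bar> < 1/2}) = {y. \<forall>i\<in>I. \<bar>cell y i - cell x i\<bar> < 1/2}"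
    by auto
  finally show ?thesis .
qed

lemma letters_eq_of_close:
  assumes "a \<in> insert 0 digits" "b \<in> insert 0 digits" "\<bar>a - b\<bar> < 1/2"
  shows "a = b"
proof -
  from assms(1,2) have "a \<in> \<int>" "b \<in> \<int>" by auto
  then obtain m n :: int where mn: "a = of_int m" "b = of_int n" by (auto elim!: Ints_cases)
  have "\<bar>of_int (m - n) :: real\<bar> < 1" using assms(3) mn by simp
  then have "\<bar>m - n\<bar> < 1" by linarith
  then show ?thesis using mn by simp
qed

lemma compact_system: "compact system"
proof -
  let ?L = "insert 0 digits"
  have "compactin (product_topology (\<lambda>_::nat. euclideanreal) UNIV) (PiE UNIV (\<lambda>_. ?L))"
    by (subst compactin_PiE) (auto intro: finite_imp_compact)
  then have cpt: "compact (PiE UNIV (\<lambda>_::nat. ?L))" by (simp add: euclidean_product_topology)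
  have sub: "system \<subseteq> PiE UNIV (\<lambda>_. ?L)"
  proof
    fix x assume "x \<in> system"
    then have "x (int_encode (int_decode n)) \<in> ?L" for n
      using system_letters[of x "int_decode n" for n] unfolding cell_def by blast
    then have "x n \<in> ?L" for n by simp
    then show "x \<in> PiE UNIV (\<lambda>_. ?L)" unfolding PiE_UNIV_domain by blast
  qed
  have "closure system \<subseteq> system"
  proof
    fix x assume x: "x \<in> closure system"
    have "closed (PiE UNIV (\<lambda>_::nat. ?L))" using cpt by (rule compact_imp_closed)
    then have "x \<in> PiE UNIV (\<lambda>_. ?L)" using x closure_minimal[OF sub] by blast
    then have L: "cell x i \<in> ?L" for i unfolding cell_def by (auto simp: PiE_iff)
    show "x \<in> system"
    proof (rule systemI_local)
      fix I :: "int set" assume I: "finite I"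
      let ?U = "{y. \<forall>i\<in>I. \<bar>cell y i - cell x i\<bar> < 1/2}"
      have "x \<in> ?U" by simp
      then have "?U \<inter> closure system \<noteq> {}" using x by blast
      then have "?U \<inter> system \<noteq> {}"
        using open_Int_closure_eq_empty[OF open_cylinder[OF I, of x], of system] by blast
      then obtain y where y: "y \<in> system" "\<forall>i\<in>I. \<bar>cell y i - cell x i\<bar> < 1/2" by blast
      then have "\<forall>i\<in>I. cell y i = cell x i"
        using L letters_eq_of_close unfolding system_def by blast
      with y show "\<exists>y\<in>system. \<forall>i\<in>I. cell y i = cell x i" by blast
    qed
  qed
  then have "closed system" using closure_subset_eq by blast
  then show ?thesis using compact_Int_closed[OF cpt, of system] sub by (simp add: Int_absorb1)
qed

text \<open>
  The metric is continuous for the product topology, because points that agree near the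
  origin are close, and a continuous image of a compact space is compact.
\<close>

lemma compact_space_system: "compact_space (Metric_space.mtopology system dist_seq)"
proof -
  interpret Metric_space system dist_seq by (rule Metric_space_dist_seq)
  have "continuous_map (top_of_set system) mtopology (\<lambda>x. x)"
    unfolding continuous_map_to_metric
  proof (intro ballI allI impI)
    fix x and \<epsilon> :: real assume x: "x \<in> topspace (top_of_set system)" and \<epsilon>: "\<epsilon> > 0"
    obtain N where N: "(1/2) ^ N < \<epsilon>" using real_arch_pow_inv[OF \<epsilon>, of "1/2"] by auto
    let ?U = "{y. \<forall>i\<in>{- int N..int N}. \<bar>cell y i - cell x i\<bar> < 1/2}"
    have "y \<in> mball x \<epsilon>" if y: "y \<in> system \<inter> ?U" for y
    proof -
      have "cell x i = cell y i" if i: "\<bar>i\<bar> \<le> int N" for i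
      proof (rule letters_eq_of_close)
        show "cell x i \<in> insert 0 digits" "cell y i \<in> insert 0 digits"
          using x y by (auto simp: system_def)
        have "i \<in> {- int N..int N}" using i by auto
        then show "\<bar>cell x i - cell y i\<bar> < 1/2" using y by (metis (mono_tags, lifting) IntE abs_minus_commute mem_Collect_eq)
      qed
      then have "dist_seq x y \<le> (1/2) ^ N" by (rule dist_seq_le_power)
      with N have "dist_seq x y < \<epsilon>" by linarith
      then show ?thesis using x y by simp
    qed
    moreover have "openin (top_of_set system) (system \<inter> ?U)"
      by (intro openin_open_Int open_cylinder) simp
    moreover have "x \<in> system \<inter> ?U" using x by simp
    ultimately show "\<exists>U. openin (top_of_set system) U \<and> x \<in> U \<and> (\<forall>y\<in>U. y \<in> mball x \<epsilon>)" by blast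
  qed
  moreover have "compactin (top_of_set system) system"
    using compact_system by (simp add: compactin_subtopology)
  ultimately have "compactin mtopology ((\<lambda>x. x) ` system)" by (rule image_compactin[rotated])
  then show ?thesis by (simp add: compact_space_def)
qed

lemma gap_shift: "gap (shift x) a b \<longleftrightarrow> gap x (a + 1) (b + 1)"
proof -
  have "(\<forall>i. a < i \<and> i < b \<longrightarrow> cell x (i + 1) = 0) \<longleftrightarrow>
      (\<forall>i. a + 1 < i \<and> i < b + 1 \<longrightarrow> cell x i = 0)"
    by (metis add_less_cancel_right diff_add_cancel)
  moreover have "a + 1 < b \<longleftrightarrow> a + 1 + 1 < b + 1" by linarith
  ultimately show ?thesis by (simp only: gap_def cell_shift)
qed

lemma paired_shift: "paired M p (shift x) \<longleftrightarrow> paired M (p + 1) x"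
proof
  assume L: "paired M p (shift x)"
  show "paired M (p + 1) x"
    unfolding paired_def
  proof (intro conjI allI impI)
    fix i
    show "cell x i \<noteq> 0 \<longleftrightarrow> i \<in> {p + 1..<p + 1 + 4 * M} \<union> {p + 1 + 5 * M..<p + 1 + 9 * M}"
      using L[unfolded paired_def, THEN conjunct1, rule_format, of "i - 1"] by auto
    show "cell x (i + 5 * M) = double (cell x i)" if "p + 1 \<le> i \<and> i < p + 1 + 4 * M"
      using L[unfolded paired_def, THEN conjunct2, rule_format, of "i - 1"] that
      by (simp add: algebra_simps)
  qed
next
  assume R: "paired M (p + 1) x"
  show "paired M p (shift x)"
    unfolding paired_def
  proof (intro conjI allI impI)
    fix i
    show "cell (shift x) i \<noteq> 0 \<longleftrightarrow> i \<in> {p..<p + 4 * M} \<union> {p + 5 * M..<p + 9 * M}"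
      using R[unfolded paired_def, THEN conjunct1, rule_format, of "i + 1"] by auto
    show "cell (shift x) (i + 5 * M) = double (cell (shift x) i)" if "p \<le> i \<and> i < p + 4 * M"
      using R[unfolded paired_def, THEN conjunct2, rule_format, of "i + 1"] that
      by (simp add: algebra_simps)
  qed
qed

lemma shift_mem_system_iff: "shift x \<in> system \<longleftrightarrow> x \<in> system"
proof -
  have A: "(\<forall>i. P (i + 1)) \<longleftrightarrow> (\<forall>i. P i)" for P :: "int \<Rightarrow> bool"
    by (metis diff_add_cancel)
  have "(\<forall>i. cell (shift x) i \<in> insert 0 digits) \<longleftrightarrow> (\<forall>i. cell x i \<in> insert 0 digits)"
    unfolding cell_shift by (rule A)
  moreover have "(\<forall>a b. gap (shift x) a b \<longrightarrow>
        (\<exists>k::nat. b = a + 20 ^ k + 1 \<and> paired (20 ^ k) (a + 1 - 4 * 20 ^ k) (shift x))) \<longleftrightarrow>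
      (\<forall>a b. gap x a b \<longrightarrow> (\<exists>k::nat. b = a + 20 ^ k + 1 \<and> paired (20 ^ k) (a + 1 - 4 * 20 ^ k) x))"
    (is "(\<forall>a b. ?P a b) \<longleftrightarrow> (\<forall>a b. ?Q a b)")
  proof -
    have "?P a b \<longleftrightarrow> ?Q (a + 1) (b + 1)" for a b
      by (simp add: gap_shift paired_shift algebra_simps)
    then have "(\<forall>a b. ?P a b) \<longleftrightarrow> (\<forall>a b. ?Q (a + 1) (b + 1))" by blast
    also have "\<dots> \<longleftrightarrow> (\<forall>a b. ?Q a b)" by (metis diff_add_cancel)
    finally show ?thesis .
  qed
  ultimately show ?thesis by (simp add: system_def)
qed

lemma bij_betw_shift: "bij_betw shift system system"
proof (rule bij_betwI')
  show "shift x = shift y \<longleftrightarrow> x = y" for x y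
  proof
    assume eq: "shift x = shift y"
    show "x = y"
    proof (rule cell_eqI)
      fix i
      show "cell x i = cell y i" using arg_cong[OF eq, of "\<lambda>z. cell z (i - 1)"] by simp
    qed
  qed simp
  show "shift x \<in> system" if "x \<in> system" for x using that by (simp add: shift_mem_system_iff)
  fix y assume y: "y \<in> system"
  define x where "x = (\<lambda>n. y (int_encode (int_decode n - 1)))"
  have "shift x = y" by (simp add: shift_def x_def)
  then show "\<exists>x\<in>system. y = shift x" using y shift_mem_system_iff by metis
qed

lemma homeomorphic_map_shift:
  "homeomorphic_map (Metric_space.mtopology system dist_seq)
     (Metric_space.mtopology system dist_seq) shift"
proof -
  interpret Metric_space system dist_seq by (rule Metric_space_dist_seq)
  have "continuous_map mtopology mtopology shift"
    unfolding metric_continuous_map[OF Metric_space_dist_seq]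
  proof (intro conjI ballI allI impI)
    show "shift ` system \<subseteq> system" using bij_betw_shift by (auto simp: bij_betw_def)
    fix x and \<epsilon> :: real assume \<epsilon>: "\<epsilon> > 0"
    obtain N where N: "(1/2) ^ N < \<epsilon>" using real_arch_pow_inv[OF \<epsilon>, of "1/2"] by auto
    have "dist_seq (shift x) (shift y) < \<epsilon>" if "dist_seq x y < (1/2) ^ Suc N" for y
    proof -
      have "dist_seq (shift x) (shift y) \<le> (1/2) ^ N"
      proof (rule dist_seq_le_power)
        fix i assume "\<bar>i\<bar> \<le> int N"
        then show "cell (shift x) i = cell (shift y) i"
          using dist_seq_less_power_imp_eq[OF that, of "i + 1"] by simp
      qed
      with N show ?thesis by linarith
    qed
    moreover have "(1/2::real) ^ Suc N > 0" by simp
    ultimately show "\<exists>\<delta>>0. \<forall>y. y \<in> system \<and> dist_seq x y < \<delta> \<longrightarrow> dist_seq (shift x) (shift y) < \<epsilon>"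
      by blast
  qed
  then show ?thesis
    using compact_space_system Hausdorff_space_mtopology bij_betw_shift
    by (intro continuous_imp_homeomorphic_map) (auto simp: bij_betw_def)
qed

section \<open>Finite entropy\<close>

text \<open>
  Agreement on \<open>N\<close> cells on both sides of the window forces \<open>dyn_dist\<close> to be at most \<open>(1/2)\<^sup>N\<close>.
  The window then has \<open>T + 2N\<close> cells.
\<close>

lemma span_num_system_le:
  assumes "T \<ge> 1" "(1/2) ^ N < \<epsilon>"
  shows "span_num system \<epsilon> (dyn_dist dist_seq shift T) \<le> enat (6 ^ (T + 2 * N))"
proof -
  let ?I = "{- int N..<int T + int N}"
  let ?Y = "PiE ?I (\<lambda>_. insert 0 digits)"
  have "span_num system \<epsilon> (dyn_dist dist_seq shift T) \<le> enat (card ?Y)"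
  proof (rule span_num_le_card[where f = "\<lambda>x. restrict (cell x) ?I"])
    show "finite ?Y" by (intro finite_PiE) auto
    show "(\<lambda>x. restrict (cell x) ?I) ` system \<subseteq> ?Y" by (auto simp: system_def)
    fix x y assume eq: "restrict (cell x) ?I = restrict (cell y) ?I"
    have "dist_seq ((shift ^^ t) x) ((shift ^^ t) y) < \<epsilon>" if t: "t < T" for t
    proof -
      have "dist_seq ((shift ^^ t) x) ((shift ^^ t) y) \<le> (1/2) ^ N"
      proof (rule dist_seq_le_power)
        fix i assume "\<bar>i\<bar> \<le> int N"
        then have "i + int t \<in> ?I" using t by auto
        then show "cell ((shift ^^ t) x) i = cell ((shift ^^ t) y) i"
          using eq by (metis cell_funpow_shift restrict_apply')
      qed
      with assms(2) show ?thesis by linarith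
    qed
    then show "dyn_dist dist_seq shift T x y < \<epsilon>" using assms(1) by (simp add: dyn_dist_less_iff)
  qed
  also have "card ?Y = 6 ^ (T + 2 * N)"
  proof (subst card_PiE)
    have "card (insert 0 digits) = 6" by simp
    moreover have "nat (int T + int N - (- int N)) = T + 2 * N" by simp
    ultimately show "(\<Prod>i\<in>?I. card (insert 0 digits)) = 6 ^ (T + 2 * N)"
      by (simp only: prod_constant card_atLeastLessThan_int)
  qed simp
  finally show ?thesis .
qed

lemma topological_entropy_system_le: "topological_entropy system dist_seq shift \<le> ereal (ln 6)"
proof (rule tendsto_upperbound[OF topological_entropy_tendsto])
  have "limsup (span_rate system dist_seq shift \<epsilon>) \<le> ereal (ln 6)" if \<epsilon>: "\<epsilon> > 0" for \<epsilon>
  proof -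
    obtain N where N: "(1/2) ^ N < \<epsilon>" using real_arch_pow_inv[OF \<epsilon>, of "1/2"] by auto
    let ?g = "\<lambda>T. ln 6 + 2 * N * ln 6 * (1 / real T)"
    have "span_rate system dist_seq shift \<epsilon> T \<le> ereal (?g T)" if T: "T \<ge> 1" for T
    proof -
      have "ln_enat (span_num system \<epsilon> (dyn_dist dist_seq shift T)) \<le> ereal (ln (6 ^ (T + 2 * N)))"
        using ln_enat_mono[OF span_num_system_le[OF T N]] by (simp add: ln_enat_def)
      then have "span_rate system dist_seq shift \<epsilon> T \<le> ereal (ln (6 ^ (T + 2 * N))) / ereal (real T)"
        unfolding span_rate_def using T by (intro ereal_divide_right_mono) auto
      also have "\<dots> = ereal (?g T)" using T by (simp add: ln_realpow field_simps)
      finally show ?thesis .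
    qed
    then have "limsup (span_rate system dist_seq shift \<epsilon>) \<le> limsup (\<lambda>T. ereal (?g T))"
      by (intro Limsup_mono eventually_sequentiallyI[of 1])
    also have "limsup (\<lambda>T. ereal (?g T)) = ereal (ln 6)"
    proof (rule lim_imp_Limsup)
      have "?g \<longlonglongrightarrow> ln 6 + 2 * N * ln 6 * 0"
        by (intro tendsto_intros lim_1_over_n)
      then show "(\<lambda>T. ereal (?g T)) \<longlonglongrightarrow> ereal (ln 6)" by simp
    qed simp
    finally show ?thesis .
  qed
  then show "\<forall>\<^sub>F \<epsilon> in at_right 0. limsup (span_rate system dist_seq shift \<epsilon>) \<le> ereal (ln 6)"
    by (simp add: eventually_at_filter)
qed simp

section \<open>Many points are needed to span at times \<open>9 \<cdot> 20\<^sup>k\<close>\<close>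

definition codeword :: "int \<Rightarrow> (nat \<Rightarrow> real) \<Rightarrow> nat \<Rightarrow> real" where
  "codeword M v = (\<lambda>n. let i = int_decode n in
    if 0 \<le> i \<and> i < 4 * M then v (nat i)
    else if 5 * M \<le> i \<and> i < 9 * M then double (v (nat (i - 5 * M)))
    else 0)"

lemma cell_codeword:
  "cell (codeword M v) i =
    (if 0 \<le> i \<and> i < 4 * M then v (nat i)
     else if 5 * M \<le> i \<and> i < 9 * M then double (v (nat (i - 5 * M))) else 0)"
  by (simp add: cell_def codeword_def)

lemma
  assumes "\<And>i. i < 4 * 20 ^ k \<Longrightarrow> v i \<in> digits"
  shows paired_codeword: "paired (20 ^ k) 0 (codeword (20 ^ k) v)"
    and codeword_in_system: "codeword (20 ^ k) v \<in> system"
proof -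
  let ?M = "20 ^ k :: int" and ?w = "codeword (20 ^ k) v"
  have M: "?M > 0" by simp
  have v: "v (nat i) \<in> digits" if "0 \<le> i" "i < 4 * ?M" for i
  proof (rule assms)
    have "int (nat i) < int (4 * 20 ^ k)" using that by simp
    then show "nat i < 4 * 20 ^ k" by linarith
  qed
  have nz: "a \<noteq> 0" if "a \<in> digits" for a using that by auto
  have supp: "cell ?w i \<noteq> 0 \<longleftrightarrow> i \<in> {0..<0 + 4 * ?M} \<union> {0 + 5 * ?M..<0 + 9 * ?M}" for i
    using nz[OF v[of i]] nz[OF double_digits[OF v[of "i - 5 * ?M"]]] M by (auto simp: cell_codeword)
  show paired: "paired ?M 0 ?w"
    unfolding paired_def
  proof (intro conjI allI impI)
    fix i assume "0 \<le> i \<and> i < 0 + 4 * ?M"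
    then show "cell ?w (i + 5 * ?M) = double (cell ?w i)" using M by (simp add: cell_codeword)
  qed (rule supp)
  show "?w \<in> system"
    unfolding system_def
  proof (intro CollectI conjI allI impI)
    show "cell ?w i \<in> insert 0 digits" for i
      using v[of i] double_digits[OF v[of "i - 5 * ?M"]] unfolding cell_codeword
      by (simp del: insert_iff add: insertI1 insertI2)
  next
    fix a b assume g: "gap ?w a b"
    have a: "cell ?w a \<noteq> 0" "cell ?w (a + 1) = 0" and b: "cell ?w b \<noteq> 0" "cell ?w (b - 1) = 0"
      and ab: "a + 1 < b" and between: "\<And>i. a < i \<Longrightarrow> i < b \<Longrightarrow> cell ?w i = 0"
      using g by (auto simp: gap_def)
    from a have "a = 4 * ?M - 1 \<or> a = 9 * ?M - 1" using M supp[of a] supp[of "a + 1"] by auto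
    moreover have "b = 0 \<or> b = 5 * ?M" using b supp[of b] supp[of "b - 1"] M by auto
    ultimately have "a = 4 * ?M - 1" "b = 5 * ?M" using ab M by auto
    then show "\<exists>k'::nat. b = a + 20 ^ k' + 1 \<and> paired (20 ^ k') (a + 1 - 4 * 20 ^ k') ?w"
      using paired by (intro exI[of _ k]) simp
  qed
qed

text \<open>
  A point \<open>s\<close> of the system that is not separated from a codeword has the same blanks in the window;
  the gap in the middle makes \<open>s\<close> a paired sequence of the same scale. At the first difference of
  the two words, either the digits are adjacent and the first copy separates, or the doubled digits
  are adjacent and the second copy does.
\<close>

lemma agree_of_not_separates:
  assumes v: "\<And>i. i < 4 * 20 ^ k \<Longrightarrow> v i \<in> digits"
    and s: "s \<in> system"
    and close: "\<And>t. t < 9 * 20 ^ k \<Longrightarrow> \<not> separates s (codeword (20 ^ k) v) (int t)"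
    and i: "i < 4 * 20 ^ k"
  shows "cell s (int i) = v i"
proof -
  let ?M = "20 ^ k :: int" and ?w = "codeword (20 ^ k) v"
  have M: "?M \<ge> 1" by simp
  have pw: "paired ?M 0 ?w" using v by (rule paired_codeword)
  have w: "?w \<in> system" using v by (rule codeword_in_system)
  have nsep: "\<not> separates s ?w t" if "0 \<le> t" "t < 9 * ?M" for t
  proof -
    have "int (nat t) < int (9 * 20 ^ k)" using that by simp
    then have "nat t < 9 * 20 ^ k" by linarith
    then show ?thesis using close[of "nat t"] that by simp
  qed
  have supp_w: "cell ?w t \<noteq> 0 \<longleftrightarrow> t \<in> {0..<4 * ?M} \<union> {5 * ?M..<9 * ?M}" for t
    using pw unfolding paired_def by simp
  have same: "cell s t \<noteq> 0 \<longleftrightarrow> cell ?w t \<noteq> 0" if "0 \<le> t" "t < 9 * ?M" for t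
    using nsep[OF that] unfolding separates_def by metis
  have "gap s (4 * ?M - 1) (5 * ?M)"
    unfolding gap_def
  proof (intro conjI allI impI)
    show "cell s (4 * ?M - 1) \<noteq> 0" "cell s (5 * ?M) \<noteq> 0"
      using same[of "4 * ?M - 1"] same[of "5 * ?M"] supp_w[of "4 * ?M - 1"] supp_w[of "5 * ?M"] M
      by simp_all
    show "cell s t = 0" if "4 * ?M - 1 < t \<and> t < 5 * ?M" for t
      using same[of t] supp_w[of t] that M by auto
  qed (use M in simp)
  with s obtain k' :: nat where "5 * ?M = 4 * ?M - 1 + 20 ^ k' + 1"
    "paired (20 ^ k') (4 * ?M - 1 + 1 - 4 * 20 ^ k') s" by (rule system_gapE)
  moreover from this have "k' = k" by simp
  ultimately have ps: "paired ?M 0 s" by simp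
  have supp_s: "cell s t \<noteq> 0 \<longleftrightarrow> t \<in> {0..<4 * ?M} \<union> {5 * ?M..<9 * ?M}" for t
    using ps unfolding paired_def by simp
  have dbl: "cell s (t + 5 * ?M) = double (cell s t)" "cell ?w (t + 5 * ?M) = double (cell ?w t)"
    if "0 \<le> t" "t < 4 * ?M" for t
    using ps pw that unfolding paired_def by simp_all
  have "cell s (int j) = cell ?w (int j)" if "int j < 4 * ?M" for j
    using that
  proof (induction j rule: less_induct)
    case (less j)
    then have eq: "cell s t = cell ?w t" if "0 \<le> t" "t < int j" for t
      using less.IH[of "nat t"] that less.prems by simp
    show ?case
    proof (rule ccontr)
      assume ne: "cell s (int j) \<noteq> cell ?w (int j)"
      have "cell s (int j) \<in> digits" "cell ?w (int j) \<in> digits"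
        using supp_s[of "int j"] supp_w[of "int j"] less.prems
          system_letters[OF s, of "int j"] system_letters[OF w, of "int j"]
        by auto
      then consider "adjacent (cell s (int j)) (cell ?w (int j))"
        | "adjacent (double (cell s (int j))) (double (cell ?w (int j)))"
        using adjacent_or_adjacent_double ne by blast
      then show False
      proof cases
        case 1
        have "cell s u = cell ?w u"
          if "u < int j" "\<forall>i. u < i \<and> i < int j \<longrightarrow> cell s i \<noteq> 0 \<and> cell ?w i \<noteq> 0" for u
          using that eq[of u] supp_s[of u] supp_w[of u] by force
        then have "separates s ?w (int j)"
          using 1 ne unfolding separates_def by blast
        then show False using nsep[of "int j"] less.prems M by simp
      next
        case 2
        let ?t = "int j + 5 * ?M"
        have adj: "adjacent (cell s ?t) (cell ?w ?t)" using 2 dbl less.prems by simp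
        have "cell s u = cell ?w u"
          if u: "u < ?t" "\<forall>i. u < i \<and> i < ?t \<longrightarrow> cell s i \<noteq> 0 \<and> cell ?w i \<noteq> 0" for u
        proof (cases "5 * ?M \<le> u")
          case True
          then show ?thesis
            using dbl[of "u - 5 * ?M"] eq[of "u - 5 * ?M"] u less.prems by simp
        next
          case False
          \<comment> \<open>Before the second copy, blanks hide any further past.\<close>
          have "\<not> (u < 5 * ?M - 1)"
            using u(2)[rule_format, of "5 * ?M - 1"] supp_s[of "5 * ?M - 1"] M by auto
          with False have "u = 5 * ?M - 1" by simp
          then show ?thesis using supp_s[of u] supp_w[of u] M by auto
        qed
        moreover have "cell s ?t \<noteq> cell ?w ?t" using adj by (auto simp: adjacent_def)
        ultimately have "separates s ?w ?t"
          using adj unfolding separates_def by blast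
        then show False using nsep[of ?t] less.prems M by simp
      qed
    qed
  qed
  moreover have "int i < int (4 * 20 ^ k)" using i by linarith
  ultimately show ?thesis by (simp add: cell_codeword)
qed

lemma span_num_system_ge:
  "enat (5 ^ (4 * 20 ^ k)) \<le> span_num system 2 (dyn_dist dist_seq shift (9 * 20 ^ k))"
  unfolding span_num_def
proof (rule INF_greatest)
  fix S assume "S \<in> {S. finite S \<and> spanning system S 2 (dyn_dist dist_seq shift (9 * 20 ^ k))}"
  then have fin: "finite S" and S: "spanning system S 2 (dyn_dist dist_seq shift (9 * 20 ^ k))"
    by simp_all
  define n :: nat where "n = 4 * 20 ^ k"
  let ?V = "PiE {..<n} (\<lambda>_. digits)"
  have "?V \<subseteq> (\<lambda>s. \<lambda>i\<in>{..<n}. cell s (int i)) ` S"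
  proof
    fix v assume v: "v \<in> ?V"
    then have dig: "\<And>i. i < 4 * 20 ^ k \<Longrightarrow> v i \<in> digits" by (auto simp: n_def PiE_iff simp del: insert_iff)
    then obtain s where s: "s \<in> S" "dyn_dist dist_seq shift (9 * 20 ^ k) s (codeword (20 ^ k) v) < 2"
      using S codeword_in_system[of k v] unfolding spanning_def by blast
    have "s \<in> system" using s(1) S by (auto simp: spanning_def)
    moreover have "(1::nat) \<le> 9 * 20 ^ k" by simp
    then have "\<not> separates s (codeword (20 ^ k) v) (int t)" if "t < 9 * 20 ^ k" for t
      using s(2) dyn_dist_ge_2_iff[of "9 * 20 ^ k" s "codeword (20 ^ k) v"] that by auto
    ultimately have "cell s (int i) = v i" if "i < n" for i
      using that agree_of_not_separates[where k = k and v = v and s = s and i = i] dig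
      unfolding n_def by blast
    then have "(\<lambda>i\<in>{..<n}. cell s (int i)) = v"
      using v by (intro ext) (auto simp: PiE_iff extensional_def)
    with s(1) show "v \<in> (\<lambda>s. \<lambda>i\<in>{..<n}. cell s (int i)) ` S" by blast
  qed
  then have "card ?V \<le> card S" using fin by (meson card_image_le card_mono finite_imageI le_trans)
  moreover have "card digits = 5" by simp
  then have "card ?V = 5 ^ n" by (simp only: card_PiE finite_lessThan prod_constant card_lessThan)
  ultimately show "enat (5 ^ (4 * 20 ^ k)) \<le> enat (card S)" by (simp add: n_def)
qed

section \<open>Few points are separated at times \<open>20\<^sup>k\<close>\<close>

lemma gap_between:
  assumes "i < j" "j < l" "cell x i \<noteq> 0" "cell x j = 0" "cell x l \<noteq> 0"
  obtains a b where "gap x a b" "i \<le> a" "b \<le> l"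
proof -
  let ?A = "{t\<in>{i..<j}. cell x t \<noteq> 0}" and ?B = "{t\<in>{j<..l}. cell x t \<noteq> 0}"
  have A: "finite ?A" "i \<in> ?A" and B: "finite ?B" "l \<in> ?B"
    using assms by (simp_all del: atLeastLessThan_iff greaterThanAtMost_iff) simp_all
  define a where "a = Max ?A"
  define b where "b = Min ?B"
  have a: "i \<le> a" "a < j" "cell x a \<noteq> 0" using Max_in[OF A(1)] A(2) unfolding a_def by auto
  have b: "j < b" "b \<le> l" "cell x b \<noteq> 0" using Min_in[OF B(1)] B(2) unfolding b_def by auto
  have "cell x t = 0" if t: "a < t" "t < b" for t
  proof (rule ccontr)
    assume nz: "cell x t \<noteq> 0"
    then consider "t < j" | "j < t" using assms(4) by (cases t j rule: linorder_cases) auto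
    then show False
    proof cases
      case 1
      then have "t \<in> ?A" using nz a t by simp
      then show False using Max_ge[OF A(1)] t unfolding a_def by fastforce
    next
      case 2
      then have "t \<in> ?B" using nz b t by simp
      then show False using Min_le[OF B(1)] t unfolding b_def by fastforce
    qed
  qed
  then have "gap x a b" using a b unfolding gap_def by simp
  then show thesis using that a b by blast
qed

definition support :: "nat \<Rightarrow> (nat \<Rightarrow> real) \<Rightarrow> nat set" where
  "support T x = {t. t < T \<and> cell x (int t) \<noteq> 0}"

lemma interval_eq_atLeastLessThan:
  fixes P :: "nat set"
  assumes "P \<subseteq> {..<T}" "\<And>i j l. i \<in> P \<Longrightarrow> l \<in> P \<Longrightarrow> i < j \<Longrightarrow> j < l \<Longrightarrow> j \<in> P"
  obtains a b where "a \<le> T" "b \<le> T" "P = {a..<b}"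
proof (cases "P = {}")
  case True
  then show thesis using that[of 0 0] by simp
next
  case False
  have fin: "finite P" using assms(1) finite_subset by blast
  have mem: "Min P \<in> P" "Max P \<in> P" using fin False by auto
  have "P = {Min P..<Suc (Max P)}"
  proof (intro equalityI subsetI)
    fix j assume j: "j \<in> {Min P..<Suc (Max P)}"
    show "j \<in> P"
      using assms(2)[OF mem, of j] j mem by (cases "j = Min P \<or> j = Max P") auto
  qed (use fin in \<open>auto simp: less_Suc_eq_le\<close>)
  moreover have "Max P < T" using mem assms(1) by auto
  moreover have "Min P \<le> Max P" using fin mem by simp
  ultimately show thesis using that[of "Min P" "Suc (Max P)"] by auto
qed

text \<open>
  Equal blanks leave only the separation by adjacent digits. A run before position \<open>t\<close> that lies inside the
  window is part of the stretch back to the last blank on which the two points agree.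
\<close>

lemma separates_imp_support:
  assumes "separates x y (int t)" "t < T" "support T x = support T y"
  shows "t \<in> support T x" "adjacent (cell x (int t)) (cell y (int t))"
    "\<And>s. s < t \<Longrightarrow> {s..<t} \<subseteq> support T x \<Longrightarrow> cell x (int s) = cell y (int s)"
proof -
  have iff: "cell x (int i) = 0 \<longleftrightarrow> cell y (int i) = 0" if "i < T" for i
    using assms(3) that unfolding support_def by blast
  have ne: "cell x (int t) \<noteq> cell y (int t)" using assms(1) unfolding separates_def by blast
  then have nz: "cell x (int t) \<noteq> 0" "cell y (int t) \<noteq> 0" using iff[OF assms(2)] by auto
  then show "t \<in> support T x" using assms(2) by (auto simp: support_def)
  show "adjacent (cell x (int t)) (cell y (int t))"
    using assms(1) nz unfolding separates_def by blast
  fix s assume s: "s < t" and run: "{s..<t} \<subseteq> support T x"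
  have "cell x j \<noteq> 0 \<and> cell y j \<noteq> 0" if j: "int s < j" "j < int t" for j
  proof -
    have "nat j \<in> {s..<t}" using j by auto
    then have "nat j \<in> support T x" using run by blast
    then show ?thesis using j iff[of "nat j"] by (auto simp: support_def)
  qed
  then show "cell x (int s) = cell y (int s)"
    using assms(1) nz s unfolding separates_def by simp
qed

lemma card_le_of_interval_support:
  assumes "finite K" "\<And>x. x \<in> K \<Longrightarrow> support T x = {a..<b}" "b \<le> T"
    and "\<And>x y. x \<in> K \<Longrightarrow> y \<in> K \<Longrightarrow> x \<noteq> y \<Longrightarrow> \<exists>t<T. separates x y (int t)"
  shows "card K \<le> 2 ^ T"
proof -
  have "card K \<le> 2 ^ (b - a)"
  proof (rule card_le_power_of_first_difference[where f = "\<lambda>x i. cell x (int (a + i))"])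
    fix x y assume xy: "x \<in> K" "y \<in> K" "x \<noteq> y"
    then obtain t where t: "t < T" "separates x y (int t)" using assms(4) by blast
    note sep = separates_imp_support[OF t(2,1)]
    have supp: "support T x = {a..<b}" "support T x = support T y" using assms(2) xy by auto
    then have ab: "a \<le> t" "t < b" using sep(1) by auto
    have "cell x (int (a + j)) = cell y (int (a + j))" if "j < t - a" for j
      using that ab supp by (intro sep(3)) auto
    then show "\<exists>t<b - a. adjacent (cell x (int (a + t))) (cell y (int (a + t))) \<and>
        (\<forall>j<t. cell x (int (a + j)) = cell y (int (a + j)))"
      using ab sep(2)[OF supp(2)] by (intro exI[of _ "t - a"]) auto
  qed (rule assms(1))
  also have "\<dots> \<le> 2 ^ T" using assms(3) by (intro power_increasing) auto
  finally show ?thesis .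
qed

lemma card_support_paired_le:
  assumes "paired M p x" "M \<ge> 0"
  shows "card (support T x) \<le> 8 * nat M"
proof -
  have "int ` support T x \<subseteq> {p..<p + 4 * M} \<union> {p + 5 * M..<p + 9 * M}"
    using assms(1) unfolding paired_def support_def by blast
  then have "card (int ` support T x) \<le> card ({p..<p + 4 * M} \<union> {p + 5 * M..<p + 9 * M})"
    by (intro card_mono) auto
  also have "\<dots> \<le> card {p..<p + 4 * M} + card {p + 5 * M..<p + 9 * M}" by (rule card_Un_le)
  also have "\<dots> = 8 * nat M" using assms(2) by (simp add: nat_mult_distrib)
  finally show ?thesis by (simp add: card_image)
qed

lemma card_le_of_small_support:
  assumes "K \<subseteq> system" "\<And>x. x \<in> K \<Longrightarrow> support T x = P"
    and "\<And>x y. x \<in> K \<Longrightarrow> y \<in> K \<Longrightarrow> x \<noteq> y \<Longrightarrow> \<exists>t<T. separates x y (int t)"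
  shows "card K \<le> 5 ^ card P"
proof (cases "K = {}")
  case False
  then have "P \<subseteq> {..<T}" using assms(2) by (force simp: support_def)
  then have fin: "finite P" using finite_subset by blast
  let ?f = "\<lambda>x. \<lambda>t\<in>P. cell x (int t)" and ?Y = "PiE P (\<lambda>_. digits)"
  have "inj_on ?f K"
  proof (rule inj_onI, rule ccontr)
    fix x y assume xy: "x \<in> K" "y \<in> K" "?f x = ?f y" "x \<noteq> y"
    then obtain t where t: "t < T" "separates x y (int t)" using assms(3) by blast
    have "t \<in> P" using separates_imp_support(1)[OF t(2,1)] xy assms(2) by simp
    then have "cell x (int t) = cell y (int t)" using xy(3) by (metis restrict_apply')
    then show False using t by (simp add: separates_def)
  qed
  moreover have "?f ` K \<subseteq> ?Y"
  proof (rule image_subsetI)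
    fix x assume x: "x \<in> K"
    have "cell x (int t) \<in> digits" if "t \<in> P" for t
    proof -
      have "cell x (int t) \<noteq> 0" using assms(2)[OF x] that by (auto simp: support_def)
      then show ?thesis using system_letters[of x "int t"] assms(1) x by auto
    qed
    then show "?f x \<in> ?Y" unfolding restrict_PiE_iff by blast
  qed
  moreover have "finite ?Y" using fin by (intro finite_PiE) auto
  ultimately have "card K \<le> card ?Y" by (rule card_inj_on_le)
  also have "card digits = 5" by simp
  then have "card ?Y = 5 ^ card P" using fin by (simp only: card_PiE prod_constant)
  finally show ?thesis .
qed simp

text \<open>
  If the window shows a single run of digits, then the five-cycle bound applies. Otherwise it shows a gap, whose
  length \<open>20\<close> to the power \<open>k'\<close> is less than \<open>T\<close>. Then \<open>k' < k\<close>, and the sequence has only \<open>8\<close> times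
  as many digits altogether, which is at most \<open>8 T / 20\<close>. Counting all words suffices, since \<open>5\<^sup>8 \<le> 2\<^bsup>20\<^esup>\<close>.
\<close>

lemma card_le_of_common_support:
  fixes k :: nat
  defines "T \<equiv> 20 ^ k"
  assumes K: "finite K" "K \<subseteq> system" "\<And>x. x \<in> K \<Longrightarrow> support T x = P"
    and sep: "\<And>x y. x \<in> K \<Longrightarrow> y \<in> K \<Longrightarrow> x \<noteq> y \<Longrightarrow> \<exists>t<T. separates x y (int t)"
  shows "card K \<le> 2 ^ T"
proof (cases "K = {}")
  case False
  then obtain x where x: "x \<in> K" by blast
  have P: "P = support T x" using K(3) x by simp
  show ?thesis
  proof (cases "\<forall>i\<in>P. \<forall>l\<in>P. \<forall>j. i < j \<and> j < l \<longrightarrow> j \<in> P")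
    case True
    have "P \<subseteq> {..<T}" by (auto simp: P support_def)
    then obtain a b where "b \<le> T" "P = {a..<b}"
      using True by (elim interval_eq_atLeastLessThan) blast+
    then show ?thesis using card_le_of_interval_support[OF K(1), of T a b] K(3) sep by blast
  next
    case False
    then obtain i j l where "i \<in> P" "l \<in> P" "i < j" "j < l" "j \<notin> P" by blast
    then have "cell x (int i) \<noteq> 0" "cell x (int l) \<noteq> 0" "cell x (int j) = 0"
      and ij: "int i < int j" "int j < int l" "l < T"
      by (auto simp: P support_def)
    then obtain a b where ab: "gap x a b" "int i \<le> a" "b \<le> int l"
      using gap_between[of "int i" "int j" "int l" x] by blast
    then obtain k' :: nat where k': "b = a + 20 ^ k' + 1" "paired (20 ^ k') (a + 1 - 4 * 20 ^ k') x"
      using system_gapE K(2) x by blast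
    have "(20::int) ^ k' < int T" using k' ab ij(3) by linarith
    then have "(20::int) ^ k' < 20 ^ k" by (simp add: T_def)
    then have "k' < k" by (rule power_less_imp_less_exp[rotated]) simp
    then have "20 ^ Suc k' \<le> T" unfolding T_def by (intro power_increasing) auto
    then have T: "20 * 20 ^ k' \<le> T" by simp
    have "card P \<le> 8 * nat (20 ^ k')" unfolding P by (rule card_support_paired_le[OF k'(2)]) simp
    also have "nat (20 ^ k') = 20 ^ k'" by (simp add: nat_power_eq)
    finally have "card P \<le> 8 * 20 ^ k'" .
    have "card K \<le> 5 ^ card P" using K(2,3) sep by (rule card_le_of_small_support)
    also have "\<dots> \<le> 5 ^ (8 * 20 ^ k')" using \<open>card P \<le> 8 * 20 ^ k'\<close> by (rule power_increasing) simp
    also have "\<dots> = (5 ^ 8) ^ 20 ^ k'" by (rule power_mult)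
    also have "\<dots> \<le> (2 ^ 20) ^ 20 ^ k'" by (rule power_mono) simp_all
    also have "\<dots> = 2 ^ (20 * 20 ^ k')" by (rule power_mult[symmetric])
    also have "\<dots> \<le> 2 ^ T" using T by (rule power_increasing) simp
    finally show ?thesis .
  qed
qed simp

lemma clipped_interval:
  "{t. t < T \<and> u \<le> int t \<and> int t < v} = {min T (nat u)..<min T (nat v)}"
  by (auto simp: min_le_iff_disj nat_le_iff zless_nat_eq_int_zless)

text \<open>
  This bounds the number of distributions of blanks over the window by a polynomial in \<open>T\<close>.
\<close>

lemma support_two_intervals:
  assumes "x \<in> system"
  obtains a b c d where "a \<le> T" "b \<le> T" "c \<le> T" "d \<le> T" "support T x = {a..<b} \<union> {c..<d}"
proof (cases "\<exists>a b. gap x a b")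
  case True
  then obtain a b where "gap x a b" by blast
  then obtain M p where "paired M p x" using system_gapE[OF assms] by blast
  then have "support T x = {t. t < T \<and> p \<le> int t \<and> int t < p + 4 * M} \<union>
      {t. t < T \<and> p + 5 * M \<le> int t \<and> int t < p + 9 * M}"
    unfolding paired_def support_def by auto
  then show thesis unfolding clipped_interval by (rule that[rotated 4]) simp_all
next
  case False
  have "support T x \<subseteq> {..<T}" by (auto simp: support_def)
  then obtain a b where "a \<le> T" "b \<le> T" "support T x = {a..<b}"
  proof (rule interval_eq_atLeastLessThan)
    fix i j l assume il: "i \<in> support T x" "l \<in> support T x" "i < j" "j < l"
    show "j \<in> support T x"
    proof (rule ccontr)
      assume "j \<notin> support T x"
      then show False
        using il False gap_between[of "int i" "int j" "int l" x] by (auto simp: support_def)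
    qed
  qed
  then show thesis using that[of a b 0 0] by simp
qed

lemma sep_num_system_le:
  fixes k :: nat
  defines "T \<equiv> 20 ^ k"
  shows "sep_num system 2 (dyn_dist dist_seq shift T) \<le> enat ((2 * T) ^ 4 * 2 ^ T)"
  unfolding sep_num_def
proof (rule SUP_least)
  fix S assume "S \<in> {S. finite S \<and> S \<subseteq> system \<and> separated S 2 (dyn_dist dist_seq shift T)}"
  then have S: "finite S" "S \<subseteq> system" "separated S 2 (dyn_dist dist_seq shift T)" by simp_all
  have T: "T \<ge> 1" by (simp add: T_def)
  let ?B = "{..T} \<times> {..T} \<times> {..T} \<times> {..T}"
  let ?g = "\<lambda>(a, b, c, d). {a..<b} \<union> {c..<d :: nat}"
  let ?Q = "?g ` ?B"
  have sep: "\<exists>t<T. separates x y (int t)" if "x \<in> S" "y \<in> S" "x \<noteq> y" for x y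
    using S(3) that dyn_dist_ge_2_iff[OF T] unfolding separated_def by blast
  have fibre: "card {x\<in>S. support T x = P} \<le> 2 ^ T" for P
    unfolding T_def by (rule card_le_of_common_support[where P = P]) (use S sep in \<open>auto simp: T_def\<close>)
  have "support T x \<in> ?Q" if "x \<in> S" for x
  proof -
    from that S(2) have "x \<in> system" by blast
    then obtain a b c d where "a \<le> T" "b \<le> T" "c \<le> T" "d \<le> T" "support T x = {a..<b} \<union> {c..<d}"
      by (rule support_two_intervals)
    then show ?thesis by (intro image_eqI[of _ _ "(a, b, c, d)"]) auto
  qed
  then have "S = (\<Union>P\<in>?Q. {x\<in>S. support T x = P})"
    by (intro equalityI subsetI UN_I) (simp_all only: mem_Collect_eq UN_iff, simp_all)
  then have "card S \<le> (\<Sum>P\<in>?Q. card {x\<in>S. support T x = P})"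
    using card_UN_le[of ?Q "\<lambda>P. {x\<in>S. support T x = P}"] by simp
  also have "\<dots> \<le> (\<Sum>P\<in>?Q. 2 ^ T)" by (rule sum_mono) (rule fibre)
  also have "\<dots> = card ?Q * 2 ^ T" by simp
  also have "\<dots> \<le> (2 * T) ^ 4 * 2 ^ T"
  proof (rule mult_right_mono)
    have "card ?Q \<le> card ?B" by (rule card_image_le) simp
    \<comment> \<open>There are \<open>T + 1\<close> choices for each of the four end points.\<close>
    also have "\<dots> = Suc T ^ 4" by (simp add: card_cartesian_product power4_eq_xxxx)
    also have "\<dots> \<le> (2 * T) ^ 4" using T by (intro power_mono) auto
    finally show "card ?Q \<le> (2 * T) ^ 4" .
  qed simp
  finally show "enat (card S) \<le> enat ((2 * T) ^ 4 * 2 ^ T)" by (simp only: enat_ord_simps)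
qed

section \<open>Oscillation of the growth rates\<close>

lemma limsup_span_rate_ge: "ereal (4 * ln 5 / 9) \<le> limsup (span_rate system dist_seq shift 2)"
proof -
  define r :: "nat \<Rightarrow> nat" where "r = (\<lambda>k. 9 * 20 ^ k)"
  have r: "strict_mono r" unfolding r_def by (rule strict_monoI) simp
  have "ereal (4 * ln 5 / 9) \<le> span_rate system dist_seq shift 2 (r k)" for k
  proof -
    have "ereal (ln (5 ^ (4 * 20 ^ k))) \<le> ln_enat (span_num system 2 (dyn_dist dist_seq shift (r k)))"
      using ln_enat_mono[OF span_num_system_ge[of k]] by (simp add: ln_enat_def r_def)
    then have "ereal (ln (5 ^ (4 * 20 ^ k))) / ereal (real (r k)) \<le> span_rate system dist_seq shift 2 (r k)"
      unfolding span_rate_def by (intro ereal_divide_right_mono) (auto simp: r_def)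
    also have "ereal (ln (5 ^ (4 * 20 ^ k))) / ereal (real (r k)) = ereal (4 * ln 5 / 9)"
      by (simp add: r_def ln_realpow)
    finally show ?thesis .
  qed
  then have "ereal (4 * ln 5 / 9) \<le> limsup (span_rate system dist_seq shift 2 \<circ> r)"
    by (intro le_Limsup) auto
  also have "\<dots> \<le> limsup (span_rate system dist_seq shift 2)" using r by (rule limsup_subseq_mono)
  finally show ?thesis .
qed

lemma liminf_sep_rate_le: "liminf (sep_rate system dist_seq shift 2) \<le> ereal (ln 2)"
proof -
  define r :: "nat \<Rightarrow> nat" where "r = (\<lambda>k. 20 ^ k)"
  have r: "strict_mono r" unfolding r_def by (rule strict_monoI) simp
  define g where "g = (\<lambda>T. 4 * ln 2 * (1 / real T) + 4 * (ln (real T) / real T) + ln 2)"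
  have le: "sep_rate system dist_seq shift 2 (r k) \<le> ereal (g (r k))" for k
  proof -
    have T: "r k > 0" by (simp add: r_def)
    have "ln (real ((2 * r k) ^ 4 * 2 ^ r k)) = ln ((2 * real (r k)) ^ 4) + ln (2 ^ r k)"
      using T by (simp add: ln_mult)
    also have "\<dots> = 4 * ln (2 * real (r k)) + r k * ln 2"
      using T by (simp only: ln_realpow)
    also have "\<dots> = 4 * (ln 2 + ln (real (r k))) + r k * ln 2"
      using T by (simp add: ln_mult)
    also have "\<dots> / real (r k) = g (r k)"
      using T by (simp add: g_def field_simps)
    finally have g: "ln (real ((2 * r k) ^ 4 * 2 ^ r k)) / real (r k) = g (r k)" .
    have "ln_enat (sep_num system 2 (dyn_dist dist_seq shift (r k)))
        \<le> ereal (ln (real ((2 * r k) ^ 4 * 2 ^ r k)))"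
      using ln_enat_mono[OF sep_num_system_le[of k]] unfolding r_def by (simp add: ln_enat_def)
    then have "sep_rate system dist_seq shift 2 (r k)
        \<le> ereal (ln (real ((2 * r k) ^ 4 * 2 ^ r k))) / ereal (real (r k))"
      unfolding sep_rate_def using T by (intro ereal_divide_right_mono) auto
    also have "\<dots> = ereal (g (r k))" using T g by simp
    finally show ?thesis .
  qed
  have "g \<longlonglongrightarrow> 4 * ln 2 * 0 + 4 * 0 + ln 2"
    unfolding g_def by (intro tendsto_intros lim_1_over_n lim_ln_over_n)
  then have "(\<lambda>k. ereal (g (r k))) \<longlonglongrightarrow> ereal (ln 2)"
    using LIMSEQ_subseq_LIMSEQ[OF _ r, of g] by (simp add: o_def)
  then have "liminf (\<lambda>k. ereal (g (r k))) = ereal (ln 2)" by (rule lim_imp_Liminf[rotated]) simp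
  moreover have "liminf (sep_rate system dist_seq shift 2) \<le> liminf (sep_rate system dist_seq shift 2 \<circ> r)"
    using r by (rule liminf_subseq_mono)
  moreover have "\<dots> \<le> liminf (\<lambda>k. ereal (g (r k)))" using le by (intro Liminf_mono) auto
  ultimately show ?thesis by simp
qed

lemma span_rate_le_sep_rate:
  assumes "T \<ge> 1"
  shows "span_rate system dist_seq shift 2 T \<le> sep_rate system dist_seq shift 2 T"
proof -
  have "span_num system 2 (dyn_dist dist_seq shift T) \<le> sep_num system 2 (dyn_dist dist_seq shift T)"
  proof (rule span_num_le_sep_num)
    show "dyn_dist dist_seq shift T x x < 2" for x
      using dyn_dist_ge_2_iff[OF assms, of x x] by (simp add: separates_def flip: not_le)
    show "dyn_dist dist_seq shift T x y = dyn_dist dist_seq shift T y x" for x y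
      unfolding dyn_dist_def by (simp add: dist_seq_sym)
  qed
  then show ?thesis
    unfolding span_rate_def sep_rate_def using assms
    by (intro ereal_divide_right_mono ln_enat_mono) auto
qed

theorem theorem2:
  shows "\<exists>(X :: (nat \<Rightarrow> real) set) (D :: (nat \<Rightarrow> real) \<Rightarrow> (nat \<Rightarrow> real) \<Rightarrow> real)
            (F :: (nat \<Rightarrow> real) \<Rightarrow> (nat \<Rightarrow> real)).
    Metric_space X D \<and>
    compact_space (Metric_space.mtopology X D) \<and>
    homeomorphic_map (Metric_space.mtopology X D) (Metric_space.mtopology X D) F \<and>
    (\<exists>\<epsilon>>0.
      liminf (\<lambda>T. span_rate X D F \<epsilon> T) < limsup (\<lambda>T. span_rate X D F \<epsilon> T) \<and>
      liminf (\<lambda>T. sep_rate X D F \<epsilon> T) < limsup (\<lambda>T. sep_rate X D F \<epsilon> T)) \<and>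
    topological_entropy X D F < \<infinity>"
proof (intro exI conjI)
  show "Metric_space system dist_seq" by (rule Metric_space_dist_seq)
  show "compact_space (Metric_space.mtopology system dist_seq)" by (rule compact_space_system)
  show "homeomorphic_map (Metric_space.mtopology system dist_seq)
      (Metric_space.mtopology system dist_seq) shift" by (rule homeomorphic_map_shift)
  show "(0::real) < 2" by simp
  have "ln ((2::real) ^ 9) < ln (5 ^ 4)" by (subst ln_less_cancel_iff) simp_all
  then have "9 * ln (2::real) < 4 * ln 5" by (simp only: ln_realpow)
  then have gap: "ereal (ln 2) < ereal (4 * ln 5 / 9)" by simp
  have liminf: "liminf (span_rate system dist_seq shift 2) \<le> liminf (sep_rate system dist_seq shift 2)"
    by (intro Liminf_mono eventually_sequentiallyI[of 1] span_rate_le_sep_rate)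
  have limsup: "limsup (span_rate system dist_seq shift 2) \<le> limsup (sep_rate system dist_seq shift 2)"
    by (intro Limsup_mono eventually_sequentiallyI[of 1] span_rate_le_sep_rate)
  show "liminf (\<lambda>T. span_rate system dist_seq shift 2 T) < limsup (\<lambda>T. span_rate system dist_seq shift 2 T)"
    "liminf (\<lambda>T. sep_rate system dist_seq shift 2 T) < limsup (\<lambda>T. sep_rate system dist_seq shift 2 T)"
    using gap liminf limsup liminf_sep_rate_le limsup_span_rate_ge by order+
  show "topological_entropy system dist_seq shift < \<infinity>"
    using topological_entropy_system_le by (auto intro: le_less_trans)
qed

end
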